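(* Let $\mathcal C$ be a topological category in which the product of any two discrete objects is discrete in $\mathcal C$, and let $\mathbb T=(T,\eta,\mu)$ be a monad in $\mathcal C$. Assume that the functor $T$ is continuous and that for each finite discrete space $F$ in $\mathcal C$ the space $TF$ is Hausdorff and locally compact. Let $\varphi:X\times X\to X$ be an associative binary operation in $\mathcal C$, and let $\Phi:TX\times TX\to TX$ be its $\mathbb T$-extension. If the set $T_fX$ of elements with finite support is dense in $TX$, then the operation $\Phi$ is associative.
   Context: A topological category is a subcategory $\mathcal C$ (not necessarily full) of the category of topological spaces and continuous maps such that: for any objects $X,Y$ of $\mathcal C$ each constant map $X\to Y$ is a morphism of $\mathcal C$; for any objects $X,Y$ of $\mathcal C$ the product $X\times Y$ is an object of $\mathcal C$, and for any object $Z$ and morphisms $f_X:Z\to X$, $f_Y:Z\to Y$ of $\mathcal C$ the map $(f_X,f_Y):Z\to X\times Y$ is a morphism of $\mathcal C$. A discrete topological space $X$ is called discrete in $\mathcal C$ (a discrete object) if $X$ is an object of $\mathcal C$ and every function from $X$ to any object of $\mathcal C$ is a morphism of $\mathcal C$. For a monad $\mathbb T=(T,\eta,\mu)$ in $\mathcal C$, the free $\mathbb T$-algebra over $X$ is $(TX,\mu_X)$; a morphism $h:TX\to TY$ of $\mathcal C$ is a morphism of free $\mathbb T$-algebras if $h\circ\mu_X=\mu_Y\circ Th$. A binary operation in $\mathcal C$ is any function $\varphi:X\times Y\to Z$ where $X,Y,Z$ are objects of $\mathcal C$ (it need not be a morphism). A binary operation $\Phi:TX\times TY\to TZ$ is a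 $\mathbb T$-extension of $\varphi$ if: (1) $\Phi(\eta_X(x),\eta_Y(y))=\eta_Z(\varphi(x,y))$ for all $x\in X$, $y\in Y$; (2) for every $b\in TY$ the right shift $\Phi^b:TX\to TZ$, $a\mapsto\Phi(a,b)$, is a morphism of free $\mathbb T$-algebras; (3) for every $x\in X$ the left shift $\Phi_{\eta_X(x)}:TY\to TZ$, $b\mapsto\Phi(\eta_X(x),b)$, is a morphism of free $\mathbb T$-algebras. The functor $T$ is continuous if for each compact Hausdorff space $K$ that is an object of $\mathcal C$ and any object $Z$ of $\mathcal C$ the map $\mathrm{Mor}(K,Z)\to\mathrm{Mor}(TK,TZ)$, $f\mapsto Tf$, is continuous with respect to the compact-open topologies on the sets of morphisms of $\mathcal C$. An element $a\in TX$ has finite support if there are a finite space $D$ discrete in $\mathcal C$ and a morphism $f:D\to X$ of $\mathcal C$ with $a\in Tf(TD)$. $T_fX$ is the set of all $a\in TX$ with finite support. An operation $\varphi:X\times X\to X$ is associative if $\varphi(\varphi(x,y),z)=\varphi(x,\varphi(y,z))$ for all $x,y,z\in X$. *)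

theory Defs
  imports "HOL-Analysis.Analysis"
begin

text \<open>
  All spaces of the category have their points in one type \<open>'u\<close>, which plays the role of the
  set-theoretic universe: an object is a value of type \<open>'u topology\<close> whose underlying set is its
  \<open>topspace\<close>. The ordered pair of the universe is an arbitrary injective function
  \<open>pr :: 'u \<Rightarrow> 'u \<Rightarrow> 'u\<close>, so that the product of two spaces is again of type \<open>'u topology\<close>.
  A map \<open>X \<rightarrow> Y\<close> is an element of \<open>topspace X \<rightarrow>\<^sub>E topspace Y\<close>, so equality of maps
  is equality in HOL, and composition is \<^const>\<open>compose\<close>.
\<close>

definition prod_space :: "('u \<Rightarrow> 'u \<Rightarrow> 'u) \<Rightarrow> 'u topology \<Rightarrow> 'u topology \<Rightarrow> 'u topology" where
  "prod_space pr X Y =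
     pullback_topology (range (case_prod pr)) (inv (case_prod pr)) (prod_topology X Y)"

lemma topspace_prod_space:
  assumes "inj (case_prod pr)"
  shows "topspace (prod_space pr X Y) = case_prod pr ` (topspace X \<times> topspace Y)"
proof -
  have inv: "inv (case_prod pr) (pr x y) = (x, y)" for x y
    using inv_f_f[OF assms, of "(x, y)"] by simp
  show ?thesis
    by (auto simp: prod_space_def topspace_pullback_topology inv)
qed

lemma homeomorphic_map_prod_space:
  assumes "inj (case_prod pr)"
  shows "homeomorphic_map (prod_topology X Y) (prod_space pr X Y) (case_prod pr)"
proof -
  have inv: "inv (case_prod pr) (case_prod pr p) = p" for p
    using inv_f_f[OF assms] by simp
  have op: "openin (prod_space pr X Y) (case_prod pr ` U) \<longleftrightarrow> openin (prod_topology X Y) U" for U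
  proof
    assume "openin (prod_space pr X Y) (case_prod pr ` U)"
    then obtain V where V: "openin (prod_topology X Y) V"
      "case_prod pr ` U = inv (case_prod pr) -` V \<inter> range (case_prod pr)"
      unfolding prod_space_def openin_pullback_topology by blast
    have "inv (case_prod pr) -` V \<inter> range (case_prod pr) = case_prod pr ` V"
      using inv by (auto simp del: split_paired_All case_prod_conv)
    then have "U = V"
      using V(2) assms by (metis inj_image_eq_iff)
    then show "openin (prod_topology X Y) U" using V by simp
  next
    assume U: "openin (prod_topology X Y) U"
    have "inv (case_prod pr) -` U \<inter> range (case_prod pr) = case_prod pr ` U"
      using inv by (auto simp del: split_paired_All case_prod_conv)
    then show "openin (prod_space pr X Y) (case_prod pr ` U)"
      unfolding prod_space_def openin_pullback_topology using U by metis
  qed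
  have ts: "case_prod pr ` topspace (prod_topology X Y) = topspace (prod_space pr X Y)"
    using topspace_prod_space[OF assms] by simp
  show ?thesis
    unfolding homeomorphic_map_def quotient_map_def
  proof (intro conjI allI impI)
    show "inj_on (case_prod pr) (topspace (prod_topology X Y))"
      using assms inj_on_subset by blast
    fix V assume V: "V \<subseteq> topspace (prod_space pr X Y)"
    let ?U = "{p \<in> topspace (prod_topology X Y). case_prod pr p \<in> V}"
    have "V \<subseteq> case_prod pr ` topspace (prod_topology X Y)" using V ts by simp
    then have "V = case_prod pr ` ?U" by (auto simp del: topspace_prod_topology case_prod_conv)
    then show "openin (prod_topology X Y) ?U = openin (prod_space pr X Y) V"
      using op by metis
  qed (rule ts)
qed

record 'u space_cat =
  Obj :: "'u topology set"
  Mor :: "'u topology \<Rightarrow> 'u topology \<Rightarrow> ('u \<Rightarrow> 'u) set"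

locale topological_category =
  fixes pr :: "'u \<Rightarrow> 'u \<Rightarrow> 'u" and C :: "'u space_cat"
  assumes inj_pr: "inj (case_prod pr)"
    and Mor_continuous: "\<And>X Y f. X \<in> Obj C \<Longrightarrow> Y \<in> Obj C \<Longrightarrow> f \<in> Mor C X Y \<Longrightarrow>
          f \<in> topspace X \<rightarrow>\<^sub>E topspace Y \<and> continuous_map X Y f"
    and id_Mor: "\<And>X. X \<in> Obj C \<Longrightarrow> (\<lambda>x\<in>topspace X. x) \<in> Mor C X X"
    and compose_Mor: "\<And>X Y Z f g. X \<in> Obj C \<Longrightarrow> Y \<in> Obj C \<Longrightarrow> Z \<in> Obj C \<Longrightarrow>
          f \<in> Mor C X Y \<Longrightarrow> g \<in> Mor C Y Z \<Longrightarrow> compose (topspace X) g f \<in> Mor C X Z"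
    and const_Mor: "\<And>X Y y. X \<in> Obj C \<Longrightarrow> Y \<in> Obj C \<Longrightarrow> y \<in> topspace Y \<Longrightarrow>
          (\<lambda>x\<in>topspace X. y) \<in> Mor C X Y"
    and prod_Obj: "\<And>X Y. X \<in> Obj C \<Longrightarrow> Y \<in> Obj C \<Longrightarrow> prod_space pr X Y \<in> Obj C"
    and pair_Mor: "\<And>X Y Z f g. X \<in> Obj C \<Longrightarrow> Y \<in> Obj C \<Longrightarrow> Z \<in> Obj C \<Longrightarrow>
          f \<in> Mor C Z X \<Longrightarrow> g \<in> Mor C Z Y \<Longrightarrow>
          (\<lambda>z\<in>topspace Z. pr (f z) (g z)) \<in> Mor C Z (prod_space pr X Y)"

definition discrete_in :: "'u space_cat \<Rightarrow> 'u topology \<Rightarrow> bool" where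
  "discrete_in C D \<longleftrightarrow> D \<in> Obj C \<and> D = discrete_topology (topspace D) \<and>
     (\<forall>Y\<in>Obj C. topspace D \<rightarrow>\<^sub>E topspace Y \<subseteq> Mor C D Y)"

text \<open>
  A morphism is determined by its domain, its codomain and its graph, so the action \<open>fmap\<close> of the
  functor on morphisms takes the domain and the codomain as arguments.
\<close>

record 'u monad_data =
  fobj :: "'u topology \<Rightarrow> 'u topology"
  fmap :: "'u topology \<Rightarrow> 'u topology \<Rightarrow> ('u \<Rightarrow> 'u) \<Rightarrow> 'u \<Rightarrow> 'u"
  unit :: "'u topology \<Rightarrow> 'u \<Rightarrow> 'u"
  mult :: "'u topology \<Rightarrow> 'u \<Rightarrow> 'u"

locale monad_in = topological_category pr C
  for pr :: "'u \<Rightarrow> 'u \<Rightarrow> 'u" and C :: "'u space_cat" +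
  fixes T :: "'u monad_data"
  assumes fobj_Obj: "\<And>X. X \<in> Obj C \<Longrightarrow> fobj T X \<in> Obj C"
    and fmap_Mor: "\<And>X Y f. X \<in> Obj C \<Longrightarrow> Y \<in> Obj C \<Longrightarrow> f \<in> Mor C X Y \<Longrightarrow>
          fmap T X Y f \<in> Mor C (fobj T X) (fobj T Y)"
    and fmap_id: "\<And>X. X \<in> Obj C \<Longrightarrow>
          fmap T X X (\<lambda>x\<in>topspace X. x) = (\<lambda>a\<in>topspace (fobj T X). a)"
    and fmap_compose: "\<And>X Y Z f g. X \<in> Obj C \<Longrightarrow> Y \<in> Obj C \<Longrightarrow> Z \<in> Obj C \<Longrightarrow>
          f \<in> Mor C X Y \<Longrightarrow> g \<in> Mor C Y Z \<Longrightarrow>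
          fmap T X Z (compose (topspace X) g f)
            = compose (topspace (fobj T X)) (fmap T Y Z g) (fmap T X Y f)"
    and unit_Mor: "\<And>X. X \<in> Obj C \<Longrightarrow> unit T X \<in> Mor C X (fobj T X)"
    and unit_natural: "\<And>X Y f. X \<in> Obj C \<Longrightarrow> Y \<in> Obj C \<Longrightarrow> f \<in> Mor C X Y \<Longrightarrow>
          compose (topspace X) (unit T Y) f = compose (topspace X) (fmap T X Y f) (unit T X)"
    and mult_Mor: "\<And>X. X \<in> Obj C \<Longrightarrow> mult T X \<in> Mor C (fobj T (fobj T X)) (fobj T X)"
    and mult_natural: "\<And>X Y f. X \<in> Obj C \<Longrightarrow> Y \<in> Obj C \<Longrightarrow> f \<in> Mor C X Y \<Longrightarrow>
          compose (topspace (fobj T (fobj T X))) (mult T Y)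
              (fmap T (fobj T X) (fobj T Y) (fmap T X Y f))
            = compose (topspace (fobj T (fobj T X))) (fmap T X Y f) (mult T X)"
    and mult_assoc: "\<And>X. X \<in> Obj C \<Longrightarrow>
          compose (topspace (fobj T (fobj T (fobj T X)))) (mult T X)
              (fmap T (fobj T (fobj T X)) (fobj T X) (mult T X))
            = compose (topspace (fobj T (fobj T (fobj T X)))) (mult T X) (mult T (fobj T X))"
    and mult_unit: "\<And>X. X \<in> Obj C \<Longrightarrow>
          compose (topspace (fobj T X)) (mult T X) (unit T (fobj T X))
            = (\<lambda>a\<in>topspace (fobj T X). a)"
    and mult_fmap_unit: "\<And>X. X \<in> Obj C \<Longrightarrow>
          compose (topspace (fobj T X)) (mult T X) (fmap T X (fobj T X) (unit T X))
            = (\<lambda>a\<in>topspace (fobj T X). a)"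

definition free_algebra_morphism ::
    "'u space_cat \<Rightarrow> 'u monad_data \<Rightarrow> 'u topology \<Rightarrow> 'u topology \<Rightarrow> ('u \<Rightarrow> 'u) \<Rightarrow> bool" where
  "free_algebra_morphism C T X Y h \<longleftrightarrow> h \<in> Mor C (fobj T X) (fobj T Y) \<and>
     compose (topspace (fobj T (fobj T X))) h (mult T X)
       = compose (topspace (fobj T (fobj T X))) (mult T Y) (fmap T (fobj T X) (fobj T Y) h)"

text \<open>
  A binary operation is any function on the product of the underlying sets, with no continuity. It is
  represented in curried form, and its values outside \<open>topspace X \<times> topspace Y\<close> are irrelevant.
\<close>

definition binary_operation ::
    "'u space_cat \<Rightarrow> 'u topology \<Rightarrow> 'u topology \<Rightarrow> 'u topology \<Rightarrow> ('u \<Rightarrow> 'u \<Rightarrow> 'u) \<Rightarrow> bool" where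
  "binary_operation C X Y Z \<phi> \<longleftrightarrow> X \<in> Obj C \<and> Y \<in> Obj C \<and> Z \<in> Obj C \<and>
     (\<forall>x\<in>topspace X. \<forall>y\<in>topspace Y. \<phi> x y \<in> topspace Z)"

definition associative_on :: "'u set \<Rightarrow> ('u \<Rightarrow> 'u \<Rightarrow> 'u) \<Rightarrow> bool" where
  "associative_on A \<phi> \<longleftrightarrow> (\<forall>x\<in>A. \<forall>y\<in>A. \<forall>z\<in>A. \<phi> (\<phi> x y) z = \<phi> x (\<phi> y z))"

definition extension_of ::
    "'u space_cat \<Rightarrow> 'u monad_data \<Rightarrow> 'u topology \<Rightarrow> 'u topology \<Rightarrow> 'u topology \<Rightarrow>
     ('u \<Rightarrow> 'u \<Rightarrow> 'u) \<Rightarrow> ('u \<Rightarrow> 'u \<Rightarrow> 'u) \<Rightarrow> bool" where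
  "extension_of C T X Y Z \<phi> \<Phi> \<longleftrightarrow>
     binary_operation C (fobj T X) (fobj T Y) (fobj T Z) \<Phi> \<and>
     (\<forall>x\<in>topspace X. \<forall>y\<in>topspace Y. \<Phi> (unit T X x) (unit T Y y) = unit T Z (\<phi> x y)) \<and>
     (\<forall>b\<in>topspace (fobj T Y).
        free_algebra_morphism C T X Z (\<lambda>a\<in>topspace (fobj T X). \<Phi> a b)) \<and>
     (\<forall>x\<in>topspace X.
        free_algebra_morphism C T Y Z (\<lambda>b\<in>topspace (fobj T Y). \<Phi> (unit T X x) b))"

definition compact_open :: "'u space_cat \<Rightarrow> 'u topology \<Rightarrow> 'u topology \<Rightarrow> ('u \<Rightarrow> 'u) topology" where
  "compact_open C X Y =
     topology_generated_by {{f \<in> Mor C X Y. f ` K \<subseteq> U} | K U. compactin X K \<and> openin Y U}"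

lemma topspace_compact_open: "topspace (compact_open C X Y) = Mor C X Y"
proof -
  have "Mor C X Y = {f \<in> Mor C X Y. f ` {} \<subseteq> {}}" by simp
  then have "Mor C X Y \<in> {{f \<in> Mor C X Y. f ` K \<subseteq> U} | K U. compactin X K \<and> openin Y U}"
    using compactin_empty openin_empty by blast
  then show ?thesis
    unfolding compact_open_def topology_generated_by_topspace by blast
qed

definition continuous_functor :: "'u space_cat \<Rightarrow> 'u monad_data \<Rightarrow> bool" where
  "continuous_functor C T \<longleftrightarrow>
     (\<forall>K\<in>Obj C. \<forall>Z\<in>Obj C. compact_space K \<and> Hausdorff_space K \<longrightarrow>
        continuous_map (compact_open C K Z) (compact_open C (fobj T K) (fobj T Z)) (fmap T K Z))"

definition finite_support :: "'u space_cat \<Rightarrow> 'u monad_data \<Rightarrow> 'u topology \<Rightarrow> 'u set" where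
  "finite_support C T X = {a \<in> topspace (fobj T X).
     \<exists>D f. discrete_in C D \<and> finite (topspace D) \<and> f \<in> Mor C D X \<and>
           a \<in> fmap T D X f ` topspace (fobj T D)}"

end

theory Submission
  imports Defs
begin

text \<open>
  A morphism \<open>h\<close> of free algebras is determined by its values on the units, since
  \<open>h = h \<circ> \<mu> \<circ> T\<eta> = \<mu> \<circ> T(h \<circ> \<eta>)\<close>. Both sides of the associative law are such morphisms in
  the first variable; once that variable is a unit they are such morphisms in the second variable,
  and once both are units in the third. So associativity on units suffices.
\<close>

context monad_in
begin

lemma unit_maps:
  assumes "X \<in> Obj C" "x \<in> topspace X"
  shows "unit T X x \<in> topspace (fobj T X)"
  using Mor_continuous[OF assms(1) fobj_Obj[OF assms(1)] unit_Mor[OF assms(1)]] assms(2) by blast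

lemma free_algebra_morphism_expand:
  assumes X: "X \<in> Obj C" and Y: "Y \<in> Obj C" and h: "free_algebra_morphism C T X Y h"
    and a: "a \<in> topspace (fobj T X)"
  shows "h a = mult T Y (fmap T X (fobj T Y) (compose (topspace X) h (unit T X)) a)"
proof -
  \<comment> \<open>By the unit law \<open>mult_fmap_unit\<close>, \<open>mult T X\<close> sends
    this point back to \<open>a\<close>. Having been produced by \<open>fmap\<close> of the unit, it
    lets functoriality merge \<open>h\<close> with the unit.\<close>
  let ?a = "fmap T X (fobj T X) (unit T X) a"
  note TX = fobj_Obj[OF X] and TY = fobj_Obj[OF Y]
  have hM: "h \<in> Mor C (fobj T X) (fobj T Y)"
    and eq: "compose (topspace (fobj T (fobj T X))) h (mult T X)
      = compose (topspace (fobj T (fobj T X))) (mult T Y) (fmap T (fobj T X) (fobj T Y) h)"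
    using h unfolding free_algebra_morphism_def by auto
  have a': "?a \<in> topspace (fobj T (fobj T X))"
    using Mor_continuous[OF TX fobj_Obj[OF TX] fmap_Mor[OF X TX unit_Mor[OF X]]] a by blast
  have "a = mult T X ?a"
    using fun_cong[OF mult_fmap_unit[OF X], of a] a by (simp add: compose_def)
  then have "h a = h (mult T X ?a)" by simp
  also have "\<dots> = mult T Y (fmap T (fobj T X) (fobj T Y) h ?a)"
    using fun_cong[OF eq, of ?a] a' by (simp add: compose_def)
  also have "fmap T (fobj T X) (fobj T Y) h ?a
      = fmap T X (fobj T Y) (compose (topspace X) h (unit T X)) a"
    using fun_cong[OF fmap_compose[OF X TX TY unit_Mor[OF X] hM], of a] a
    by (simp add: compose_def)
  finally show ?thesis .
qed

lemma free_algebra_morphism_eqI: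
  assumes X: "X \<in> Obj C" and Y: "Y \<in> Obj C"
    and g: "free_algebra_morphism C T X Y g" and h: "free_algebra_morphism C T X Y h"
    and eq: "\<And>x. x \<in> topspace X \<Longrightarrow> g (unit T X x) = h (unit T X x)"
    and a: "a \<in> topspace (fobj T X)"
  shows "g a = h a"
proof -
  \<comment> \<open>\<open>compose\<close> yields extensional functions, so agreement at the points
    of \<open>X\<close> is equality in HOL, and \<open>fmap\<close> then receives the same argument
    on both sides.\<close>
  have "compose (topspace X) g (unit T X) = compose (topspace X) h (unit T X)"
    using eq by (auto simp: compose_def)
  then show ?thesis
    using free_algebra_morphism_expand[OF X Y g a] free_algebra_morphism_expand[OF X Y h a] by simp
qed

text \<open>The squares for \<open>g\<close> and \<open>h\<close> paste together because
  \<open>T\<close> preserves composition. This is what turns iterated shifts, the two sides of the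
  associative law, into morphisms of free algebras.\<close>

lemma free_algebra_morphism_compose:
  assumes X: "X \<in> Obj C" and Y: "Y \<in> Obj C" and Z: "Z \<in> Obj C"
    and g: "free_algebra_morphism C T X Y g" and h: "free_algebra_morphism C T Y Z h"
  shows "free_algebra_morphism C T X Z (compose (topspace (fobj T X)) h g)"
proof -
  note TX = fobj_Obj[OF X] and TY = fobj_Obj[OF Y] and TZ = fobj_Obj[OF Z]
  have gM: "g \<in> Mor C (fobj T X) (fobj T Y)" and hM: "h \<in> Mor C (fobj T Y) (fobj T Z)"
    using g h unfolding free_algebra_morphism_def by auto
  have "compose (topspace (fobj T X)) h g (mult T X a)
      = mult T Z (fmap T (fobj T X) (fobj T Z) (compose (topspace (fobj T X)) h g) a)"
    if a: "a \<in> topspace (fobj T (fobj T X))" for a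
  proof -
    let ?b = "fmap T (fobj T X) (fobj T Y) g a"
    have \<mu>a: "mult T X a \<in> topspace (fobj T X)"
      using Mor_continuous[OF fobj_Obj[OF TX] TX mult_Mor[OF X]] a by blast
    have b: "?b \<in> topspace (fobj T (fobj T Y))"
      using Mor_continuous[OF fobj_Obj[OF TX] fobj_Obj[OF TY] fmap_Mor[OF TX TY gM]] a by blast
    have "g (mult T X a) = mult T Y ?b"
      using g a unfolding free_algebra_morphism_def by (metis compose_eq)
    moreover have "h (mult T Y ?b) = mult T Z (fmap T (fobj T Y) (fobj T Z) h ?b)"
      using h b unfolding free_algebra_morphism_def by (metis compose_eq)
    ultimately show ?thesis
      using \<mu>a a by (simp add: compose_eq fmap_compose[OF TX TY TZ gM hM])
  qed
  then show ?thesis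
    unfolding free_algebra_morphism_def
    using compose_Mor[OF TX TY TZ gM hM]
    by (auto simp: compose_def fun_eq_iff)
qed

text \<open>Right shifts are morphisms at every point, left shifts only at units. Hence a variable
  can be freed only while all variables to its left are units, which forces the order third, second,
  first.\<close>

lemma extension_associative:
  assumes assoc: "associative_on (topspace X) \<phi>"
    and \<phi>: "binary_operation C X X X \<phi>" and \<Phi>: "extension_of C T X X X \<phi> \<Phi>"
  shows "associative_on (topspace (fobj T X)) \<Phi>"
proof -
  let ?T = "topspace (fobj T X)" and ?\<eta> = "unit T X"
  define R where "R b = (\<lambda>a\<in>?T. \<Phi> a b)" for b
  define L where "L x = (\<lambda>b\<in>?T. \<Phi> (?\<eta> x) b)" for x
  have X: "X \<in> Obj C" and \<phi>_closed: "\<And>x y. x \<in> topspace X \<Longrightarrow> y \<in> topspace X \<Longrightarrow> \<phi> x y \<in> topspace X"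
    using \<phi> unfolding binary_operation_def by auto
  note \<eta> = unit_maps[OF X] and eqI = free_algebra_morphism_eqI[OF X X]
    and comp = free_algebra_morphism_compose[OF X X X]
  have closed: "\<Phi> a b \<in> ?T" if "a \<in> ?T" "b \<in> ?T" for a b
    using \<Phi> that unfolding extension_of_def binary_operation_def by blast
  have units: "\<Phi> (?\<eta> x) (?\<eta> y) = ?\<eta> (\<phi> x y)" if "x \<in> topspace X" "y \<in> topspace X" for x y
    using \<Phi> that unfolding extension_of_def by blast
  have R: "free_algebra_morphism C T X X (R b)" if "b \<in> ?T" for b
    using \<Phi> that unfolding extension_of_def R_def by blast
  have L: "free_algebra_morphism C T X X (L x)" if "x \<in> topspace X" for x
    using \<Phi> that unfolding extension_of_def L_def by blast
  have unit2: "\<Phi> (\<Phi> (?\<eta> x) (?\<eta> y)) c = \<Phi> (?\<eta> x) (\<Phi> (?\<eta> y) c)"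
    if "x \<in> topspace X" "y \<in> topspace X" "c \<in> ?T" for x y c
  proof -
    \<comment> \<open>The product of two units is the unit at \<open>\<phi> x y\<close>, so
      multiplying by it from the left is again a left shift at a unit.\<close>
    have "L (\<phi> x y) c = compose ?T (L x) (L y) c"
    proof (rule eqI[OF L comp[OF L L] _ \<open>c \<in> ?T\<close>])
      fix z assume "z \<in> topspace X"
      then show "L (\<phi> x y) (?\<eta> z) = compose ?T (L x) (L y) (?\<eta> z)"
        \<comment> \<open>At three units both sides are values of \<open>?\<eta>\<close>, and their
          equality is associativity of \<open>\<phi>\<close>.\<close>
        using assoc that by (simp add: L_def compose_eq \<eta> closed units \<phi>_closed associative_on_def)
    qed (use that \<phi>_closed in auto)
    then show ?thesis
      using that by (simp add: L_def compose_eq \<eta> closed units)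
  qed
  have unit1: "\<Phi> (\<Phi> (?\<eta> x) b) c = \<Phi> (?\<eta> x) (\<Phi> b c)"
    if "x \<in> topspace X" "b \<in> ?T" "c \<in> ?T" for x b c
  proof -
    \<comment> \<open>With the outer variables fixed, the law says that a right shift commutes with
      a left shift at a unit; at \<open>b = ?\<eta> y\<close> this is \<open>unit2\<close>.\<close>
    have "compose ?T (R c) (L x) b = compose ?T (L x) (R c) b"
    proof (rule eqI[OF comp[OF L R] comp[OF R L] _ \<open>b \<in> ?T\<close>])
      fix y assume "y \<in> topspace X"
      then show "compose ?T (R c) (L x) (?\<eta> y) = compose ?T (L x) (R c) (?\<eta> y)"
        using that unit2 by (simp add: L_def R_def compose_eq \<eta> closed)
    qed (use that in auto)
    then show ?thesis
      using that by (simp add: L_def R_def compose_eq \<eta> closed)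
  qed
  have "\<Phi> (\<Phi> a b) c = \<Phi> a (\<Phi> b c)" if "a \<in> ?T" "b \<in> ?T" "c \<in> ?T" for a b c
  proof -
    \<comment> \<open>Now only right shifts occur, so \<open>b\<close> and \<open>c\<close> may be
      arbitrary; the right side is a single shift, by the point \<open>\<Phi> b c\<close>.\<close>
    have "compose ?T (R c) (R b) a = R (\<Phi> b c) a"
    proof (rule eqI[OF comp[OF R R] R _ \<open>a \<in> ?T\<close>])
      fix x assume "x \<in> topspace X"
      then show "compose ?T (R c) (R b) (?\<eta> x) = R (\<Phi> b c) (?\<eta> x)"
        using that unit1 by (simp add: R_def compose_eq \<eta> closed)
    qed (use that closed in auto)
    then show ?thesis
      using that by (simp add: R_def compose_eq closed)
  qed
  then show ?thesis
    unfolding associative_on_def by blast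
qed

end

theorem theorem5p2:
  fixes pr :: "'u \<Rightarrow> 'u \<Rightarrow> 'u"
    and C :: "'u space_cat"
    and T :: "'u monad_data"
    and X :: "'u topology"
    and \<phi> \<Phi> :: "'u \<Rightarrow> 'u \<Rightarrow> 'u"
  assumes "topological_category pr C"
    and "\<And>D E. discrete_in C D \<Longrightarrow> discrete_in C E \<Longrightarrow> discrete_in C (prod_space pr D E)"
    and "monad_in pr C T"
    and "continuous_functor C T"
    and "\<And>F. discrete_in C F \<Longrightarrow> finite (topspace F) \<Longrightarrow>
           Hausdorff_space (fobj T F) \<and> locally_compact_space (fobj T F)"
    and "binary_operation C X X X \<phi>"
    and "associative_on (topspace X) \<phi>"
    and "extension_of C T X X X \<phi> \<Phi>"
    and "fobj T X closure_of finite_support C T X = topspace (fobj T X)"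
  shows "associative_on (topspace (fobj T X)) \<Phi>"
  using assms by (blast intro: monad_in.extension_associative)

end
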